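(* Let $A = K\langle x_1,\dots,x_n \mid f_1,\dots,f_m\rangle$ and suppose that the homogenizing element $x_0$ is not a zero divisor in the homogenization $H(A)$. Let $\mathcal{Z}(-)$ denote the center of an algebra. Then, identifying generators (so that $H(\mathcal{Z}(A))$ is viewed inside $H(A)$), one has $\mathcal{Z}(H(A)) = H(\mathcal{Z}(A))$.
   Context: $K$ is an algebraically closed field of characteristic zero and all algebras are $K$-algebras. An algebra $A=K\langle x_1,\dots,x_n\mid f_1,\dots,f_m\rangle$ is given by generators $x_i$, all of degree 1, and polynomial relations $f_j$. For a noncommutative polynomial $f$ of degree $\alpha$ in $x_1,\dots,x_n$, its homogenization $\hat f$ is obtained by multiplying each monomial of degree $\beta\le\alpha$ occurring in $f$ by $x_0^{\alpha-\beta}$, where $x_0$ is a new central indeterminate. The homogenization $H(A)$ is the $K$-algebra on generators $x_0,x_1,\dots,x_n$ subject to the relations $\hat f_1,\dots,\hat f_m$ and $x_0x_i-x_ix_0$ for $i=1,\dots,n$. $H(\mathcal{Z}(A))$ denotes the $K$-subalgebra of $H(A)$ generated by $x_0$ and the homogenizations $\hat f$ of the elements $f\in\mathcal{Z}(A)$, where $\hat f\in H(A)$ is the homogenization of a representative of $f$ of least degree in the generators $x_1,\dots,x_n$ (when $x_0$ is not a zero divisor this element of $H(A)$ is well defined). *)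

theory Defs
  imports
    "HOL-Algebra.QuotRing"
    "HOL-Algebra.Generated_Rings"
    "HOL-Library.Poly_Mapping"
    "HOL-Computational_Algebra.Polynomial"
begin

text \<open>
  Noncommutative monomials form the free monoid of words. It is written additively because the
  convolution product of \<^typ>\<open>'a \<Rightarrow>\<^sub>0 'b\<close> is based on \<^class>\<open>monoid_add\<close>, which does not assume
  commutativity. Thus finitely supported functions on words are the noncommutative polynomials.
\<close>

datatype 'x word = Word (letters: "'x list")

instantiation word :: (type) monoid_add
begin

definition zero_word :: "'a word" where
  "0 = Word []"

definition plus_word :: "'a word \<Rightarrow> 'a word \<Rightarrow> 'a word" where
  "u + v = Word (letters u @ letters v)"

instance
  by standard (auto simp: zero_word_def plus_word_def)

end

type_synonym ('x, 'k) ncpoly = "'x word \<Rightarrow>\<^sub>0 'k"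

definition const :: "'k::field \<Rightarrow> ('x, 'k) ncpoly" where
  "const c = Poly_Mapping.single 0 c"

definition var :: "'x \<Rightarrow> ('x, 'k::field) ncpoly" where
  "var x = Poly_Mapping.single (Word [x]) 1"

definition free_algebra :: "'x set \<Rightarrow> ('x, 'k::field) ncpoly ring" where
  "free_algebra X =
    \<lparr>carrier = {p. \<forall>w\<in>Poly_Mapping.keys p. set (letters w) \<subseteq> X},
     monoid.mult = (*), one = 1, zero = 0, add = (+)\<rparr>"

lemma ring_free_algebra: "ring (free_algebra X :: ('x, 'k::field) ncpoly ring)"
proof -
  let ?C = "carrier (free_algebra X :: ('x, 'k) ncpoly ring)"
  have mem: "p \<in> ?C \<longleftrightarrow> (\<forall>w\<in>Poly_Mapping.keys p. set (letters w) \<subseteq> X)"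
    for p :: "('x, 'k) ncpoly"
    by (simp add: free_algebra_def)
  have mult: "p * q \<in> ?C" if "p \<in> ?C" "q \<in> ?C" for p q :: "('x, 'k) ncpoly"
    unfolding mem
  proof
    fix w assume "w \<in> Poly_Mapping.keys (p * q)"
    then obtain u v where "u \<in> Poly_Mapping.keys p" "v \<in> Poly_Mapping.keys q" "w = u + v"
      using keys_mult[of p q] by blast
    then show "set (letters w) \<subseteq> X"
      using that unfolding mem by (simp add: plus_word_def)
  qed
  have add: "p + q \<in> ?C" if "p \<in> ?C" "q \<in> ?C" for p q :: "('x, 'k) ncpoly"
    using that Poly_Mapping.keys_add[of p q] unfolding mem by blast
  have neg: "- p \<in> ?C" if "p \<in> ?C" for p :: "('x, 'k) ncpoly"
    using that unfolding mem by simp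
  have zero: "0 \<in> ?C" and one: "1 \<in> ?C"
    unfolding mem by (simp_all add: zero_word_def)
  have inv: "\<exists>q\<in>?C. q + p = 0" if "p \<in> ?C" for p :: "('x, 'k) ncpoly"
    using neg[OF that] by (intro bexI[of _ "- p"]) simp_all
  have ops: "x \<otimes>\<^bsub>free_algebra X\<^esub> y = x * y" "x \<oplus>\<^bsub>free_algebra X\<^esub> y = x + y"
    "\<one>\<^bsub>free_algebra X\<^esub> = 1" "\<zero>\<^bsub>free_algebra X\<^esub> = 0" for x y :: "('x, 'k) ncpoly"
    by (simp_all add: free_algebra_def)
  show ?thesis
    by (intro ringI abelian_groupI monoidI; unfold ops)
      ((fact mult add inv zero one |
        rule mult.assoc add.assoc add.commute distrib_left distrib_right
        add_0_left mult_1_left mult_1_right))+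
qed

text \<open>
  The algebra with generators \<open>X\<close> and relations \<open>R\<close>, i.e. the free algebra modulo the
  two-sided ideal generated by \<open>R\<close>, and the residue class in it of a polynomial.
\<close>

definition presented_algebra :: "'x set \<Rightarrow> ('x, 'k::field) ncpoly set \<Rightarrow> ('x, 'k) ncpoly set ring"
  where "presented_algebra X R = free_algebra X Quot (Idl\<^bsub>free_algebra X\<^esub> R)"

definition residue :: "'x set \<Rightarrow> ('x, 'k::field) ncpoly set \<Rightarrow> ('x, 'k) ncpoly \<Rightarrow> ('x, 'k) ncpoly set"
  where "residue X R p = (Idl\<^bsub>free_algebra X\<^esub> R) +>\<^bsub>free_algebra X\<^esub> p"

text \<open>
  A subring is a \<open>K\<close>-subalgebra iff it contains the scalars, hence the \<open>K\<close>-subalgebra generated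
  by \<open>S\<close> is the subring generated by \<open>S\<close> and the scalars.
\<close>

definition generated_subalgebra ::
    "'x set \<Rightarrow> ('x, 'k::field) ncpoly set \<Rightarrow> ('x, 'k) ncpoly set set \<Rightarrow> ('x, 'k) ncpoly set set"
  where "generated_subalgebra X R S =
    generate_ring (presented_algebra X R) (range (\<lambda>c. residue X R (const c)) \<union> S)"

definition ring_center :: "('a, 'b) ring_scheme \<Rightarrow> 'a set" where
  "ring_center R = {z \<in> carrier R. \<forall>a\<in>carrier R. z \<otimes>\<^bsub>R\<^esub> a = a \<otimes>\<^bsub>R\<^esub> z}"

definition zero_divisor :: "('a, 'b) ring_scheme \<Rightarrow> 'a \<Rightarrow> bool" where
  "zero_divisor R a \<longleftrightarrow> a \<in> carrier R \<and>
    (\<exists>b\<in>carrier R. b \<noteq> \<zero>\<^bsub>R\<^esub> \<and> (a \<otimes>\<^bsub>R\<^esub> b = \<zero>\<^bsub>R\<^esub> \<or> b \<otimes>\<^bsub>R\<^esub> a = \<zero>\<^bsub>R\<^esub>))"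

text \<open>All generators have degree \<open>1\<close>; the zero polynomial gets degree \<open>0\<close>.\<close>

definition ncdegree :: "('x, 'k::field) ncpoly \<Rightarrow> nat" where
  "ncdegree p = Max (insert 0 ((\<lambda>w. length (letters w)) ` Poly_Mapping.keys p))"

text \<open>
  From here on variables are indexed by natural numbers: \<open>x\<^sub>1, \<dots>, x\<^sub>n\<close> are the generators of the
  algebra \<open>A\<close>, and index \<open>0\<close> is reserved for the homogenizing element \<open>x\<^sub>0\<close>. In the free algebra
  \<open>x\<^sub>0\<close> does not commute with the other variables, so we fix its position on the left of each
  monomial; modulo the relations of \<open>H(A)\<close> the position is irrelevant.
\<close>

definition homogenize :: "(nat, 'k::field) ncpoly \<Rightarrow> (nat, 'k) ncpoly" where
  "homogenize p = (\<Sum>w\<in>Poly_Mapping.keys p.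
    var 0 ^ (ncdegree p - length (letters w)) * Poly_Mapping.single w (Poly_Mapping.lookup p w))"

definition homogenized_relations ::
    "nat \<Rightarrow> (nat, 'k::field) ncpoly set \<Rightarrow> (nat, 'k) ncpoly set" where
  "homogenized_relations n R =
    homogenize ` R \<union> {var 0 * var i - var i * var 0 | i. i \<in> {1..n}}"

definition homogenization ::
    "nat \<Rightarrow> (nat, 'k::field) ncpoly set \<Rightarrow> (nat, 'k) ncpoly set ring" where
  "homogenization n R = presented_algebra {0..n} (homogenized_relations n R)"

definition hom_residue ::
    "nat \<Rightarrow> (nat, 'k::field) ncpoly set \<Rightarrow> (nat, 'k) ncpoly \<Rightarrow> (nat, 'k) ncpoly set" where
  "hom_residue n R p = residue {0..n} (homogenized_relations n R) p"

definition least_degree_rep ::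
    "nat \<Rightarrow> (nat, 'k::field) ncpoly set \<Rightarrow> (nat, 'k) ncpoly \<Rightarrow> bool" where
  "least_degree_rep n R p \<longleftrightarrow> p \<in> carrier (free_algebra {1..n}) \<and>
    (\<forall>q\<in>carrier (free_algebra {1..n}).
      residue {1..n} R q = residue {1..n} R p \<longrightarrow> ncdegree p \<le> ncdegree q)"

text \<open>
  The subalgebra \<open>H(Z(A))\<close> of \<open>H(A)\<close>. A central element of \<open>A\<close> may have several representatives of
  least degree; all of them are used. If \<open>x\<^sub>0\<close> is not a zero divisor in \<open>H(A)\<close>, their
  homogenizations agree in \<open>H(A)\<close>.
\<close>

definition homogenized_center ::
    "nat \<Rightarrow> (nat, 'k::field) ncpoly set \<Rightarrow> (nat, 'k) ncpoly set set" where
  "homogenized_center n R =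
    generated_subalgebra {0..n} (homogenized_relations n R)
      (insert (hom_residue n R (var 0))
        {hom_residue n R (homogenize p) | p.
          least_degree_rep n R p \<and> residue {1..n} R p \<in> ring_center (presented_algebra {1..n} R)})"

end

theory Submission
  imports Defs
begin

text \<open>
  Let \<open>I\<close> and \<open>J\<close> be the ideals of relations of \<open>A\<close> and \<open>H(A)\<close>, and for \<open>d \<ge> deg p\<close> let \<open>h\<^sub>d p\<close> be
  \<open>p\<close> filled up with \<open>x\<^sub>0\<close> to degree \<open>d\<close>. Setting \<open>x\<^sub>0 = 1\<close> maps \<open>J\<close> into \<open>I\<close>; conversely
  \<open>h\<^sub>d p \<in> J\<close> for some \<open>d\<close> if \<open>p \<in> I\<close>, hence for all \<open>d \<ge> deg p\<close> when \<open>x\<^sub>0\<close> is regular. Applied to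
  the commutators \<open>x\<^sub>i p - p x\<^sub>i\<close> this shows that the homogenization of a central element is central.
  Since \<open>J\<close> is homogeneous, the components of a central element of \<open>H(A)\<close> are central. A central
  component \<open>p\<close> of degree \<open>d\<close> dehomogenizes to a central element of \<open>A\<close>, and if \<open>q\<close> is a
  representative of the latter of least degree \<open>e\<close>, then \<open>p = h\<^sub>d q = x\<^sub>0\<^sup>d\<^sup>-\<^sup>e h\<^sub>e q\<close> in \<open>H(A)\<close>.
\<close>

section \<open>Words and induction on the terms of a polynomial\<close>

abbreviation wlen :: "'x word \<Rightarrow> nat" where
  "wlen w \<equiv> length (letters w)"

lemma letters_plus [simp]: "letters (u + v) = letters u @ letters v"
  by (simp add: plus_word_def)

lemma letters_zero [simp]: "letters 0 = []"
  by (simp add: zero_word_def)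

text \<open>A polynomial is the finite sum of its terms, so an additive statement has to be checked
  on single terms only. The set \<open>S\<close> carries what is known about the occurring words,
  such as their letters or a bound on their length, into the \<open>single\<close> case.\<close>

lemma poly_mapping_linear_induct [consumes 1, case_names zero single add]:
  fixes p :: "'x \<Rightarrow>\<^sub>0 'k::comm_monoid_add"
  assumes "Poly_Mapping.keys p \<subseteq> S"
    and zero: "P 0"
    and single: "\<And>w c. w \<in> S \<Longrightarrow> P (Poly_Mapping.single w c)"
    and add: "\<And>p q. P p \<Longrightarrow> P q \<Longrightarrow> P (p + q)"
  shows "P p"
proof -
  have "P (\<Sum>w\<in>K. Poly_Mapping.single w (Poly_Mapping.lookup p w))" if "finite K" "K \<subseteq> S" for K
    using that by (induction K rule: finite_induct) (auto intro: zero single add)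
  moreover have "p = (\<Sum>w\<in>Poly_Mapping.keys p. Poly_Mapping.single w (Poly_Mapping.lookup p w))"
    by (rule poly_mapping_eqI)
      (auto simp: lookup_sum lookup_single when_def in_keys_iff)
  ultimately show ?thesis
    using assms(1) finite_keys by metis
qed

lemma poly_mapping_induct [case_names zero single add]:
  fixes p :: "'x \<Rightarrow>\<^sub>0 'k::comm_monoid_add"
  assumes "P 0" and "\<And>w c. P (Poly_Mapping.single w c)"
    and "\<And>p q. P p \<Longrightarrow> P q \<Longrightarrow> P (p + q)"
  shows "P p"
  using assms by (rule poly_mapping_linear_induct[OF subset_UNIV])

subsection \<open>Linear extension of maps on words\<close>

text \<open>Homogeneous components, homogenization to a fixed degree and the substitution x_0 = 1
  are all given on words; as instances of this map they inherit linearity at once.\<close>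

definition linear_extension ::
    "('x word \<Rightarrow> ('y, 'k::field) ncpoly) \<Rightarrow> ('x, 'k) ncpoly \<Rightarrow> ('y, 'k) ncpoly" where
  "linear_extension m p = (\<Sum>w\<in>Poly_Mapping.keys p. const (Poly_Mapping.lookup p w) * m w)"

lemma const_0 [simp]: "const 0 = 0"
  by (simp add: const_def)

lemma const_add: "const (a + b) = const a + const b"
  by (simp add: const_def single_add)

lemma const_mult: "const (a * b) = const a * const b"
  by (simp add: const_def mult_single)

lemma const_times_single [simp]:
  "const c * Poly_Mapping.single w a = Poly_Mapping.single w (c * a)"
  by (simp add: const_def mult_single)

lemma const_commute: "p * const c = const c * p"
proof (induction p rule: poly_mapping_induct)
  case (single w a)
  then show ?case
    by (simp add: const_def mult_single mult.commute)
qed (simp_all add: distrib_left distrib_right)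

lemma linear_extension_0 [simp]: "linear_extension m 0 = 0"
  by (simp add: linear_extension_def)

lemma linear_extension_single [simp]:
  "linear_extension m (Poly_Mapping.single w c) = const c * m w"
  by (simp add: linear_extension_def)

lemma linear_extension_add [simp]:
  "linear_extension m (p + q) = linear_extension m p + linear_extension m q"
  unfolding linear_extension_def
  by (rule setsum_keys_plus_distrib) (simp_all add: const_add distrib_right)

lemma linear_extension_diff [simp]:
  "linear_extension m (p - q) = linear_extension m p - linear_extension m q"
  using linear_extension_add[of m "p - q" q] by (simp add: algebra_simps)

text \<open>Both sides are additive in \<open>p\<close> and in \<open>q\<close>, which reduces the
  claim to two terms; there the scalar of the second one has to be moved past
  \<open>m u\<close>.\<close>

lemma linear_extension_mult:
  assumes "\<And>u v. m (u + v) = m u * m v"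
  shows "linear_extension m (p * q) = linear_extension m p * linear_extension m q"
proof (induction p rule: poly_mapping_induct)
  case (single u a)
  show ?case
  proof (induction q rule: poly_mapping_induct)
    case (single v b)
    have "const a * const b * (m u * m v) = const a * (m u * const b) * m v"
      by (simp add: const_commute[of "m u"] mult.assoc)
    then show ?case
      by (simp add: mult_single assms const_mult mult.assoc)
  qed (simp_all add: distrib_left)
qed (simp_all add: distrib_right)

subsection \<open>Ideals of free algebras\<close>

lemma free_algebra_simps [simp]:
  "x \<otimes>\<^bsub>free_algebra X\<^esub> y = x * y" "x \<oplus>\<^bsub>free_algebra X\<^esub> y = x + y"
  "\<one>\<^bsub>free_algebra X\<^esub> = 1" "\<zero>\<^bsub>free_algebra X\<^esub> = 0"
  by (simp_all add: free_algebra_def)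

lemma free_algebra_carrier_iff:
  "p \<in> carrier (free_algebra X) \<longleftrightarrow> (\<forall>w\<in>Poly_Mapping.keys p. set (letters w) \<subseteq> X)"
  by (simp add: free_algebra_def)

lemma free_algebra_closed [intro]:
  fixes p q :: "('x, 'k::field) ncpoly"
  shows zero_in_free_algebra: "0 \<in> carrier (free_algebra X)"
    and one_in_free_algebra: "1 \<in> carrier (free_algebra X)"
    and "p \<in> carrier (free_algebra X) \<Longrightarrow> q \<in> carrier (free_algebra X)
      \<Longrightarrow> p + q \<in> carrier (free_algebra X)"
    and "p \<in> carrier (free_algebra X) \<Longrightarrow> q \<in> carrier (free_algebra X)
      \<Longrightarrow> p * q \<in> carrier (free_algebra X)"
  using ring.ring_simprules(1,2,5,6)[OF ring_free_algebra[of X]] by auto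

lemma uminus_in_free_algebra [intro]:
  "p \<in> carrier (free_algebra X) \<Longrightarrow> - p \<in> carrier (free_algebra X)"
  by (auto simp: free_algebra_carrier_iff in_keys_iff)

lemma diff_in_free_algebra [intro]:
  "p \<in> carrier (free_algebra X) \<Longrightarrow> q \<in> carrier (free_algebra X)
    \<Longrightarrow> p - q \<in> carrier (free_algebra X)"
  using free_algebra_closed(3)[of p X "- q"] uminus_in_free_algebra[of q X] by simp

lemma free_algebra_a_inv:
  "p \<in> carrier (free_algebra X) \<Longrightarrow> \<ominus>\<^bsub>free_algebra X\<^esub> p = - p"
  using ring.is_abelian_group[OF ring_free_algebra[of X]]
  by (intro abelian_group.minus_equality) auto

lemma free_algebra_a_minus:
  "p \<in> carrier (free_algebra X) \<Longrightarrow> q \<in> carrier (free_algebra X)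
    \<Longrightarrow> p \<ominus>\<^bsub>free_algebra X\<^esub> q = p - q"
  by (simp add: a_minus_def free_algebra_a_inv)

lemma single_in_free_algebra [intro]:
  "set (letters w) \<subseteq> X \<Longrightarrow> Poly_Mapping.single w c \<in> carrier (free_algebra X)"
  by (simp add: free_algebra_carrier_iff)

lemma const_in_free_algebra [intro]: "const c \<in> carrier (free_algebra X)"
  by (auto simp: const_def)

lemma var_in_free_algebra [intro]: "x \<in> X \<Longrightarrow> var x \<in> carrier (free_algebra X)"
  by (auto simp: var_def)

lemma power_in_free_algebra [intro]:
  "p \<in> carrier (free_algebra X) \<Longrightarrow> p ^ k \<in> carrier (free_algebra X)"
  by (induction k) auto

lemma sum_in_free_algebra:
  "(\<And>i. i \<in> A \<Longrightarrow> p i \<in> carrier (free_algebra X)) \<Longrightarrow> sum p A \<in> carrier (free_algebra X)"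
  by (induction A rule: infinite_finite_induct) auto

lemma linear_extension_in_free_algebra:
  assumes "p \<in> carrier (free_algebra X)"
    and "\<And>w. set (letters w) \<subseteq> X \<Longrightarrow> m w \<in> carrier (free_algebra Y)"
  shows "linear_extension m p \<in> carrier (free_algebra Y)"
  unfolding linear_extension_def using assms
  by (intro sum_in_free_algebra) (auto simp: free_algebra_carrier_iff[of _ X])

lemma free_algebra_mono: "X \<subseteq> Y \<Longrightarrow> carrier (free_algebra X) \<subseteq> carrier (free_algebra Y)"
  unfolding subset_iff free_algebra_carrier_iff by blast

text \<open>Phrasing closure with the operations on polynomials, instead of those of the ring
  record, lets membership proofs rearrange terms by \<open>algebra_simps\<close>.\<close>

lemma free_algebra_ideal_closed:
  assumes "ideal J (free_algebra X)"
  shows "J \<subseteq> carrier (free_algebra X)" and "0 \<in> J"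
    and "p \<in> J \<Longrightarrow> q \<in> J \<Longrightarrow> p + q \<in> J"
    and "p \<in> J \<Longrightarrow> - p \<in> J"
    and "p \<in> J \<Longrightarrow> q \<in> J \<Longrightarrow> p - q \<in> J"
    and "p \<in> J \<Longrightarrow> q \<in> carrier (free_algebra X) \<Longrightarrow> q * p \<in> J"
    and "p \<in> J \<Longrightarrow> q \<in> carrier (free_algebra X) \<Longrightarrow> p * q \<in> J"
proof -
  interpret ideal J "free_algebra X" by fact
  show "J \<subseteq> carrier (free_algebra X)" "0 \<in> J"
    using a_subset additive_subgroup.zero_closed[OF is_additive_subgroup] by auto
  show add: "p + q \<in> J" if "p \<in> J" "q \<in> J" for p q
    using additive_subgroup.a_closed[OF is_additive_subgroup that] by simp
  show neg: "- p \<in> J" if "p \<in> J" for p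
    using I_l_closed[OF that uminus_in_free_algebra[OF one_in_free_algebra]] by simp
  show "p - q \<in> J" if "p \<in> J" "q \<in> J"
    using add[OF that(1) neg[OF that(2)]] by simp
  show "q * p \<in> J" "p * q \<in> J" if "p \<in> J" "q \<in> carrier (free_algebra X)"
    using I_l_closed[OF that] I_r_closed[OF that] by auto
qed

text \<open>The elements of the free algebra satisfying \<open>P\<close> form an ideal containing
  \<open>S\<close>, hence they contain the generated one. Multiplication by single terms suffices
  because every factor is a sum of terms; closure under negation is multiplication by -1.\<close>

lemma free_algebra_genideal_induct [consumes 2, case_names zero add gen left right]:
  fixes a :: "('x, 'k::field) ncpoly"
  assumes S: "S \<subseteq> carrier (free_algebra X)"
    and a: "a \<in> Idl\<^bsub>free_algebra X\<^esub> S"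
    and zero: "P 0"
    and add: "\<And>p q. P p \<Longrightarrow> P q \<Longrightarrow> P (p + q)"
    and gen: "\<And>p. p \<in> S \<Longrightarrow> P p"
    and left: "\<And>p u c. p \<in> carrier (free_algebra X) \<Longrightarrow> P p \<Longrightarrow> set (letters u) \<subseteq> X
      \<Longrightarrow> P (Poly_Mapping.single u c * p)"
    and right: "\<And>p u c. p \<in> carrier (free_algebra X) \<Longrightarrow> P p \<Longrightarrow> set (letters u) \<subseteq> X
      \<Longrightarrow> P (p * Poly_Mapping.single u c)"
  shows "P a"
proof -
  let ?F = "free_algebra X :: ('x, 'k) ncpoly ring"
  let ?K = "{p \<in> carrier ?F. P p}"
  interpret F: ring ?F by (rule ring_free_algebra)
  have mult: "P (q * p) \<and> P (p * q)" if "p \<in> ?K" "q \<in> carrier ?F" for p q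
  proof -
    have "Poly_Mapping.keys q \<subseteq> {w. set (letters w) \<subseteq> X}"
      using that by (auto simp: free_algebra_carrier_iff)
    then show ?thesis
      using that(1)
      by (induction q rule: poly_mapping_linear_induct)
        (auto simp: distrib_left distrib_right intro: zero add left right)
  qed
  have "ideal ?K ?F"
  proof (rule idealI)
    show "subgroup ?K (add_monoid ?F)"
    proof (rule group.subgroupI)
      show "Group.group (add_monoid ?F)" by (rule F.a_group)
      show "inv\<^bsub>add_monoid ?F\<^esub> p \<in> ?K" if "p \<in> ?K" for p
      proof -
        have "inv\<^bsub>add_monoid ?F\<^esub> p = (- 1) * p"
          using that free_algebra_a_inv[of p X] by (simp add: a_inv_def)
        then show ?thesis
          using mult[OF that, of "- 1"] that by auto
      qed
    qed (use zero add in auto)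
  qed (use mult F.ring_axioms in auto)
  then have "Idl\<^bsub>?F\<^esub> S \<subseteq> ?K"
    using S gen by (intro F.genideal_minimal) auto
  then show ?thesis
    using a by auto
qed

text \<open>Commutation with \<open>q\<close> is a derivation: [xy, q] = x [y, q] + [x, q] y.
  Induction on the length of a word therefore reduces the claim to the generators, and additivity
  passes from words to polynomials.\<close>

lemma commutator_in_ideal:
  fixes p q :: "('x, 'k::field) ncpoly"
  assumes J: "ideal J (free_algebra X)"
    and q: "q \<in> carrier (free_algebra X)"
    and gens: "\<And>x. x \<in> X \<Longrightarrow> var x * q - q * var x \<in> J"
    and p: "p \<in> carrier (free_algebra X)"
  shows "p * q - q * p \<in> J"
proof -
  note J_closed = free_algebra_ideal_closed[OF J]
  have word: "Poly_Mapping.single (Word xs) c * q - q * Poly_Mapping.single (Word xs) c \<in> J"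
    if "set xs \<subseteq> X" for xs c
    using that
  proof (induction xs)
    case Nil
    have "Poly_Mapping.single (Word []) c = (const c :: ('x, 'k) ncpoly)"
      by (simp add: const_def zero_word_def)
    then show ?case
      by (simp add: const_commute J_closed(2))
  next
    case (Cons x xs)
    let ?s = "Poly_Mapping.single (Word xs) c"
    have split: "Poly_Mapping.single (Word (x # xs)) c = var x * ?s"
      by (simp add: var_def mult_single plus_word_def)
    have "var x * (?s * q - q * ?s) + (var x * q - q * var x) * ?s \<in> J"
    proof (rule J_closed(3))
      show "var x * (?s * q - q * ?s) \<in> J"
        using Cons by (intro J_closed(6) var_in_free_algebra) auto
      show "(var x * q - q * var x) * ?s \<in> J"
        using Cons.prems by (intro J_closed(7) gens single_in_free_algebra) auto
    qed
    then show ?case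
      unfolding split by (simp add: algebra_simps)
  qed
  have "Poly_Mapping.keys p \<subseteq> {w. set (letters w) \<subseteq> X}"
    using p by (auto simp: free_algebra_carrier_iff)
  then show ?thesis
  proof (induction p rule: poly_mapping_linear_induct)
    case (single w c)
    then show ?case
      using word[of "letters w" c] by simp
  next
    case (add p p')
    then have "(p * q - q * p) + (p' * q - q * p') \<in> J"
      by (rule J_closed(3))
    then show ?case
      by (simp add: algebra_simps)
  qed (simp add: J_closed(2))
qed

subsection \<open>Residue classes and centers\<close>

context
  fixes X :: "'x set" and S :: "('x, 'k::field) ncpoly set"
  assumes S: "S \<subseteq> carrier (free_algebra X)"
begin

lemma presented_ideal: "ideal (Idl\<^bsub>free_algebra X\<^esub> S) (free_algebra X)"
  using S by (intro ring.genideal_ideal ring_free_algebra)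

lemma ring_presented_algebra: "ring (presented_algebra X S)"
  unfolding presented_algebra_def by (rule ideal.quotient_is_ring[OF presented_ideal])

lemma residue_ring_hom: "residue X S \<in> ring_hom (free_algebra X) (presented_algebra X S)"
  using ideal.rcos_ring_hom[OF presented_ideal]
  by (simp add: presented_algebra_def residue_def[abs_def])

lemma residue_closed: "p \<in> carrier (free_algebra X) \<Longrightarrow> residue X S p \<in> carrier (presented_algebra X S)"
  using ring_hom_closed[OF residue_ring_hom] .

lemma residue_add:
  "p \<in> carrier (free_algebra X) \<Longrightarrow> q \<in> carrier (free_algebra X)
    \<Longrightarrow> residue X S (p + q) = residue X S p \<oplus>\<^bsub>presented_algebra X S\<^esub> residue X S q"
  using ring_hom_add[OF residue_ring_hom] by simp

lemma residue_mult:
  "p \<in> carrier (free_algebra X) \<Longrightarrow> q \<in> carrier (free_algebra X)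
    \<Longrightarrow> residue X S (p * q) = residue X S p \<otimes>\<^bsub>presented_algebra X S\<^esub> residue X S q"
  using ring_hom_mult[OF residue_ring_hom] by simp

lemma residue_zero: "residue X S 0 = \<zero>\<^bsub>presented_algebra X S\<^esub>"
  using ring_hom_zero[OF residue_ring_hom ring_free_algebra ring_presented_algebra] by simp

lemma residue_eq_iff:
  "p \<in> carrier (free_algebra X) \<Longrightarrow> q \<in> carrier (free_algebra X)
    \<Longrightarrow> residue X S p = residue X S q \<longleftrightarrow> p - q \<in> Idl\<^bsub>free_algebra X\<^esub> S"
  using ring.quotient_eq_iff_same_a_r_cos[OF ring_free_algebra presented_ideal, of p q]
  by (simp add: residue_def free_algebra_a_minus)

lemma presented_algebra_cases:
  assumes "a \<in> carrier (presented_algebra X S)"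
  obtains p where "p \<in> carrier (free_algebra X)" "a = residue X S p"
  using assms that by (auto simp: presented_algebra_def residue_def FactRing_def A_RCOSETS_def')

text \<open>This turns centrality in a quotient into ideal membership of commutators with
  generators, the form in which it is carried between A and H(A). The converse direction uses that
  every element of the quotient is a residue and that commutators with generators control all
  commutators.\<close>

lemma residue_in_center_iff:
  assumes "p \<in> carrier (free_algebra X)"
  shows "residue X S p \<in> ring_center (presented_algebra X S) \<longleftrightarrow>
    (\<forall>x\<in>X. var x * p - p * var x \<in> Idl\<^bsub>free_algebra X\<^esub> S)"
proof
  assume central: "residue X S p \<in> ring_center (presented_algebra X S)"
  show "\<forall>x\<in>X. var x * p - p * var x \<in> Idl\<^bsub>free_algebra X\<^esub> S"
  proof
    fix x assume "x \<in> X"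
    then have x: "var x \<in> carrier (free_algebra X)" by auto
    have "residue X S p \<otimes>\<^bsub>presented_algebra X S\<^esub> residue X S (var x) =
        residue X S (var x) \<otimes>\<^bsub>presented_algebra X S\<^esub> residue X S p"
      using central residue_closed[OF x] by (auto simp: ring_center_def)
    then have "residue X S (var x * p) = residue X S (p * var x)"
      by (simp add: assms x residue_mult)
    then show "var x * p - p * var x \<in> Idl\<^bsub>free_algebra X\<^esub> S"
      using assms x by (subst (asm) residue_eq_iff) auto
  qed
next
  assume gens: "\<forall>x\<in>X. var x * p - p * var x \<in> Idl\<^bsub>free_algebra X\<^esub> S"
  have "residue X S p \<otimes>\<^bsub>presented_algebra X S\<^esub> a = a \<otimes>\<^bsub>presented_algebra X S\<^esub> residue X S p"
    if a: "a \<in> carrier (presented_algebra X S)" for a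
  proof -
    from a obtain q where q: "q \<in> carrier (free_algebra X)" "a = residue X S q"
      by (rule presented_algebra_cases)
    have "residue X S (q * p) = residue X S (p * q)"
      using assms q gens
      by (subst residue_eq_iff) (auto intro: commutator_in_ideal[OF presented_ideal])
    then show ?thesis
      using assms q by (simp add: residue_mult)
  qed
  then show "residue X S p \<in> ring_center (presented_algebra X S)"
    using assms by (auto simp: ring_center_def residue_closed)
qed

end

text \<open>The center is a subring, so it contains the subring generated by any of its
  subsets.\<close>

lemma (in ring) generate_ring_subset_center:
  assumes "H \<subseteq> ring_center R"
  shows "generate_ring R H \<subseteq> ring_center R"
proof
  fix z assume "z \<in> generate_ring R H"
  then show "z \<in> ring_center R"
  proof induction
    case (incl h)
    then show ?case using assms by auto
  next
    case (eng_mult h1 h2)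
    then have h: "h1 \<in> carrier R" "h2 \<in> carrier R"
      and c: "\<And>a. a \<in> carrier R \<Longrightarrow> h1 \<otimes> a = a \<otimes> h1" "\<And>a. a \<in> carrier R \<Longrightarrow> h2 \<otimes> a = a \<otimes> h2"
      by (auto simp: ring_center_def)
    have "h1 \<otimes> h2 \<otimes> a = a \<otimes> (h1 \<otimes> h2)" if a: "a \<in> carrier R" for a
    proof -
      have "h1 \<otimes> h2 \<otimes> a = h1 \<otimes> a \<otimes> h2"
        using h a by (simp only: m_assoc c(2))
      also have "\<dots> = a \<otimes> (h1 \<otimes> h2)"
        using h a by (simp only: m_assoc c(1)[OF a])
      finally show ?thesis .
    qed
    then show ?case
      using h by (simp add: ring_center_def)
  next
    case (a_inv h)
    then show ?case by (simp add: ring_center_def l_minus r_minus)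
  next
    case (eng_add h1 h2)
    then show ?case by (simp add: ring_center_def l_distr r_distr)
  qed (simp add: ring_center_def)
qed

subsection \<open>Homogeneous components\<close>

definition component :: "nat \<Rightarrow> ('x, 'k::field) ncpoly \<Rightarrow> ('x, 'k) ncpoly" where
  "component d = linear_extension (\<lambda>w. if wlen w = d then Poly_Mapping.single w 1 else 0)"

lemma component_0 [simp]: "component d 0 = 0"
  and component_add [simp]: "component d (p + q) = component d p + component d q"
  and component_diff [simp]: "component d (p - q) = component d p - component d q"
  by (simp_all add: component_def)

lemma component_single:
  "component d (Poly_Mapping.single w c) = (if wlen w = d then Poly_Mapping.single w c else 0)"
  by (simp add: component_def)

lemma lookup_component:
  "Poly_Mapping.lookup (component d p) w = (if wlen w = d then Poly_Mapping.lookup p w else 0)"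
  by (induction p rule: poly_mapping_induct)
    (auto simp: component_single lookup_add lookup_single when_def)

lemma keys_component: "Poly_Mapping.keys (component d p) = {w \<in> Poly_Mapping.keys p. wlen w = d}"
  by (auto simp: in_keys_iff lookup_component split: if_splits)

lemma component_in_free_algebra [intro]:
  "p \<in> carrier (free_algebra X) \<Longrightarrow> component d p \<in> carrier (free_algebra X)"
  by (auto simp: free_algebra_carrier_iff keys_component)

lemma component_homogeneous:
  assumes "Poly_Mapping.keys p \<subseteq> {w. wlen w = e}"
  shows "component d p = (if d = e then p else 0)"
  using assms by (intro poly_mapping_eqI) (auto simp: lookup_component in_keys_iff)

text \<open>Multiplication by a term shifts degrees by the length of its word. The case distinction
  guards the truncated subtraction: in degrees below \<open>wlen u\<close> the product has no
  component.\<close>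

lemma component_single_times:
  "component d (Poly_Mapping.single u c * p) =
    (if wlen u \<le> d then Poly_Mapping.single u c * component (d - wlen u) p else 0)"
  by (induction p rule: poly_mapping_induct)
    (auto simp: mult_single component_single distrib_left)

lemma component_times_single:
  "component d (p * Poly_Mapping.single u c) =
    (if wlen u \<le> d then component (d - wlen u) p * Poly_Mapping.single u c else 0)"
  by (induction p rule: poly_mapping_induct)
    (auto simp: mult_single component_single distrib_right)

section \<open>Degrees of noncommutative polynomials\<close>

lemma wlen_le_ncdegree: "w \<in> Poly_Mapping.keys p \<Longrightarrow> wlen w \<le> ncdegree p"
  unfolding ncdegree_def by (rule Max_ge) auto

lemma ncdegree_le_iff: "ncdegree p \<le> d \<longleftrightarrow> Poly_Mapping.keys p \<subseteq> {w. wlen w \<le> d}"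
  unfolding ncdegree_def by auto

lemma ncdegree_add_le: "ncdegree p \<le> d \<Longrightarrow> ncdegree q \<le> d \<Longrightarrow> ncdegree (p + q) \<le> d"
  using Poly_Mapping.keys_add[of p q] unfolding ncdegree_le_iff by blast

lemma ncdegree_diff_le:
  assumes "ncdegree p \<le> d" and "ncdegree q \<le> d"
  shows "ncdegree (p - q) \<le> d"
proof -
  have "Poly_Mapping.keys (p - q) \<subseteq> Poly_Mapping.keys p \<union> Poly_Mapping.keys q"
    by (auto simp: in_keys_iff lookup_minus)
  then show ?thesis
    using assms unfolding ncdegree_le_iff by blast
qed

lemma ncdegree_mult_le: "ncdegree (p * q) \<le> ncdegree p + ncdegree q"
  unfolding ncdegree_le_iff
proof
  fix w assume "w \<in> Poly_Mapping.keys (p * q)"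
  then obtain u v where "u \<in> Poly_Mapping.keys p" "v \<in> Poly_Mapping.keys q" "w = u + v"
    using keys_mult[of p q] by blast
  then show "w \<in> {w. wlen w \<le> ncdegree p + ncdegree q}"
    using add_mono[OF wlen_le_ncdegree wlen_le_ncdegree] by simp
qed

lemma ncdegree_single_le: "ncdegree (Poly_Mapping.single w c) \<le> wlen w"
  by (simp add: ncdegree_def)

lemma ncdegree_var: "ncdegree (var x :: ('x, 'k::field) ncpoly) = 1"
  by (simp add: ncdegree_def var_def)

lemma sum_components: "(\<Sum>d\<le>ncdegree p. component d p) = p"
proof (rule poly_mapping_eqI)
  fix w
  show "Poly_Mapping.lookup (\<Sum>d\<le>ncdegree p. component d p) w = Poly_Mapping.lookup p w"
    using wlen_le_ncdegree[of w p]
    by (auto simp: lookup_sum lookup_component in_keys_iff)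
qed

text \<open>An ideal generated by homogeneous elements is homogeneous: a component of a generator is
  the generator itself or zero, and multiplication by a term only shifts components.\<close>

lemma component_genideal:
  assumes S: "S \<subseteq> carrier (free_algebra X)"
    and homogeneous: "\<And>p. p \<in> S \<Longrightarrow> \<exists>e. Poly_Mapping.keys p \<subseteq> {w. wlen w = e}"
    and p: "p \<in> Idl\<^bsub>free_algebra X\<^esub> S"
  shows "component d p \<in> Idl\<^bsub>free_algebra X\<^esub> S"
proof -
  note J_closed = free_algebra_ideal_closed[OF presented_ideal[OF S]]
  \<comment> \<open>The degree is quantified inside the induction because multiplication by a term
    changes it.\<close>
  have "\<forall>d. component d p \<in> Idl\<^bsub>free_algebra X\<^esub> S"
    using S p
  proof (induction p rule: free_algebra_genideal_induct)
    case (gen p)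
    then show ?case
      using homogeneous[OF gen] ring.genideal_self[OF ring_free_algebra S] J_closed(2)
      by (auto simp: component_homogeneous)
  next
    case (left p u c)
    then show ?case
      using J_closed(2) J_closed(6)[OF _ single_in_free_algebra] by (simp add: component_single_times)
  next
    case (right p u c)
    then show ?case
      using J_closed(2) J_closed(7)[OF _ single_in_free_algebra] by (simp add: component_times_single)
  qed (simp_all add: J_closed(2,3))
  then show ?thesis ..
qed

subsection \<open>Homogenization and dehomogenization\<close>

text \<open>With a fixed target degree homogenization becomes linear, whereas the degree used by
  \<open>homogenize\<close> drops when leading terms cancel. Words longer than \<open>d\<close> are
  left unchanged by the truncated subtraction, so the result is homogeneous of degree
  \<open>d\<close> only if \<open>ncdegree p \<le> d\<close>.\<close>

definition homogenize_to :: "nat \<Rightarrow> (nat, 'k::field) ncpoly \<Rightarrow> (nat, 'k) ncpoly" where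
  "homogenize_to d = linear_extension (\<lambda>w. var 0 ^ (d - wlen w) * Poly_Mapping.single w 1)"

text \<open>This is the substitution x_0 = 1: erasing the letter 0 replaces it by the empty word,
  that is, by 1.\<close>

definition dehomogenize :: "(nat, 'k::field) ncpoly \<Rightarrow> (nat, 'k) ncpoly" where
  "dehomogenize = linear_extension
    (\<lambda>w. Poly_Mapping.single (Word (filter (\<lambda>i. i \<noteq> 0) (letters w))) 1)"

lemma homogenize_to_linear [simp]:
  "homogenize_to d 0 = 0"
  "homogenize_to d (p + q) = homogenize_to d p + homogenize_to d q"
  "homogenize_to d (p - q) = homogenize_to d p - homogenize_to d q"
  by (simp_all add: homogenize_to_def)

lemma dehomogenize_linear [simp]:
  "dehomogenize 0 = 0"
  "dehomogenize (p + q) = dehomogenize p + dehomogenize q"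
  "dehomogenize (p - q) = dehomogenize p - dehomogenize q"
  by (simp_all add: dehomogenize_def)

lemma const_left_commute: "const c * (p * q) = p * (const c * q)"
  by (simp add: const_commute[symmetric, of c] mult.assoc)

lemma homogenize_to_single:
  "homogenize_to d (Poly_Mapping.single w c) = var 0 ^ (d - wlen w) * Poly_Mapping.single w c"
  by (simp add: homogenize_to_def const_left_commute)

lemma homogenize_eq: "homogenize p = homogenize_to (ncdegree p) p"
  by (simp add: homogenize_def homogenize_to_def linear_extension_def const_left_commute)

lemma dehomogenize_single:
  "dehomogenize (Poly_Mapping.single w c) =
    Poly_Mapping.single (Word (filter (\<lambda>i. i \<noteq> 0) (letters w))) c"
  by (simp add: dehomogenize_def)

lemma dehomogenize_mult [simp]: "dehomogenize (p * q) = dehomogenize p * dehomogenize q"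
  unfolding dehomogenize_def
  by (rule linear_extension_mult) (simp add: mult_single plus_word_def)

lemma dehomogenize_var:
  "dehomogenize (var 0) = 1" "i \<noteq> 0 \<Longrightarrow> dehomogenize (var i) = var i"
  by (simp_all add: var_def dehomogenize_single flip: zero_word_def)

lemma var_power: "var x ^ k = Poly_Mapping.single (Word (replicate k x)) 1"
  by (induction k) (simp_all add: var_def mult_single plus_word_def flip: zero_word_def)

lemma homogenize_to_in_free_algebra:
  assumes "p \<in> carrier (free_algebra {1..n})"
  shows "homogenize_to d p \<in> carrier (free_algebra {0..n})"
  unfolding homogenize_to_def
proof (rule linear_extension_in_free_algebra)
  show "p \<in> carrier (free_algebra {0..n})"
    using assms free_algebra_mono[of "{1..n}" "{0..n}"] by auto
qed (intro free_algebra_closed(4) power_in_free_algebra var_in_free_algebra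
  single_in_free_algebra, auto)

lemma dehomogenize_in_free_algebra:
  "p \<in> carrier (free_algebra {0..n}) \<Longrightarrow> dehomogenize p \<in> carrier (free_algebra {1..n})"
  unfolding dehomogenize_def
  by (erule linear_extension_in_free_algebra, rule single_in_free_algebra) auto

lemma keys_homogenize_to:
  assumes "ncdegree p \<le> d"
  shows "Poly_Mapping.keys (homogenize_to d p) \<subseteq> {w. wlen w = d}"
  using assms unfolding ncdegree_le_iff
proof (induction p rule: poly_mapping_linear_induct)
  case (add p q)
  then show ?case
    using Poly_Mapping.keys_add[of "homogenize_to d p" "homogenize_to d q"] by auto
qed (auto simp: homogenize_to_single var_power mult_single)

text \<open>Setting x_0 = 1 erases exactly the inserted power of x_0, whatever \<open>d\<close> is,
  since \<open>p\<close> itself does not involve x_0.\<close>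

lemma dehomogenize_homogenize_to:
  assumes "p \<in> carrier (free_algebra {1..n})"
  shows "dehomogenize (homogenize_to d p) = p"
proof -
  have "Poly_Mapping.keys p \<subseteq> {w. set (letters w) \<subseteq> {1..n}}"
    using assms by (auto simp: free_algebra_carrier_iff)
  then show ?thesis
  proof (induction p rule: poly_mapping_linear_induct)
    case (single w c)
    then have "filter (\<lambda>i. i \<noteq> 0) (letters w) = letters w"
      by (auto simp: filter_id_conv)
    then show ?case
      by (simp add: homogenize_to_single var_power mult_single dehomogenize_single)
  qed simp_all
qed

text \<open>The bound on the degree keeps the subtraction in the exponent exact, so raising the
  target degree by \<open>k\<close> inserts \<open>k\<close> further factors x_0 in every
  term.\<close>

lemma homogenize_to_shift:
  assumes "ncdegree p \<le> d"
  shows "homogenize_to (d + k) p = var 0 ^ k * homogenize_to d p"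
  using assms unfolding ncdegree_le_iff
proof (induction p rule: poly_mapping_linear_induct)
  case (single w c)
  then have "d + k - wlen w = k + (d - wlen w)" by simp
  then show ?case
    by (simp add: homogenize_to_single power_add mult.assoc)
qed (simp_all add: distrib_left)

text \<open>Since x_0 is inserted on the left, a right factor does not interfere and equality holds
  already in the free algebra. For left factors it holds only modulo the commutators with
  x_0.\<close>

lemma homogenize_to_times_single:
  assumes "ncdegree p \<le> d"
  shows "homogenize_to (d + wlen u) (p * Poly_Mapping.single u c)
    = homogenize_to d p * Poly_Mapping.single u c"
  using assms unfolding ncdegree_le_iff
  by (induction p rule: poly_mapping_linear_induct)
    (simp_all add: homogenize_to_single mult_single mult.assoc distrib_right)

subsection \<open>The ideal of the homogenization\<close>

locale graded_presentation =
  fixes n :: nat and R :: "(nat, 'k::field) ncpoly set"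
  assumes relations: "R \<subseteq> carrier (free_algebra {1..n})"
begin

declare One_nat_def [simp del] \<comment> \<open>it would turn \<open>{1..n}\<close> into \<open>{Suc 0..n}\<close>\<close>

abbreviation "I \<equiv> Idl\<^bsub>free_algebra {1..n}\<^esub> R"
abbreviation "J \<equiv> Idl\<^bsub>free_algebra {0..n}\<^esub> (homogenized_relations n R)"

lemma var_0: "(var 0 :: (nat, 'k) ncpoly) \<in> carrier (free_algebra {0..n})"
  by auto

lemma homogenized_relations: "homogenized_relations n R \<subseteq> carrier (free_algebra {0..n})"
proof -
  have "homogenize r \<in> carrier (free_algebra {0..n})" if "r \<in> R" for r
    using that relations by (auto simp: homogenize_eq homogenize_to_in_free_algebra)
  moreover have "var 0 * var i - var i * var 0 \<in> carrier (free_algebra {0..n})" if "i \<in> {1..n}" for i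
    using that by (intro diff_in_free_algebra free_algebra_closed(4) var_in_free_algebra) auto
  ultimately show ?thesis
    by (auto simp: homogenized_relations_def)
qed

lemmas I_closed = free_algebra_ideal_closed[OF presented_ideal[OF relations]]
lemmas J_closed = free_algebra_ideal_closed[OF presented_ideal[OF homogenized_relations]]

text \<open>It suffices to commute x_0 with the generators, and for x_1, ..., x_n this is, up to
  sign, a defining relation of H(A).\<close>

lemma var_0_central:
  assumes "p \<in> carrier (free_algebra {0..n})"
  shows "p * var 0 - var 0 * p \<in> J"
proof (rule commutator_in_ideal[OF presented_ideal[OF homogenized_relations] var_0 _ assms])
  fix i assume i: "i \<in> {0..n}"
  show "var i * var 0 - var 0 * var i \<in> J"
  proof (cases "i = 0")
    case False
    then have "var 0 * var i - var i * var 0 \<in> homogenized_relations n R"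
      using i by (auto simp: homogenized_relations_def)
    then have "var 0 * var i - var i * var 0 \<in> J"
      using ring.genideal_self[OF ring_free_algebra homogenized_relations] by blast
    from J_closed(4)[OF this] show ?thesis by simp
  qed (simp add: J_closed(2))
qed

lemma var_0_power_central:
  assumes "p \<in> carrier (free_algebra {0..n})"
  shows "p * var 0 ^ k - var 0 ^ k * p \<in> J"
proof (induction k)
  case (Suc k)
  have "(p * var 0 - var 0 * p) * var 0 ^ k + var 0 * (p * var 0 ^ k - var 0 ^ k * p) \<in> J"
    using Suc assms by (intro J_closed(3,6,7) var_0_central power_in_free_algebra var_0)
  then show ?case
    by (simp add: algebra_simps)
qed (simp add: J_closed(2))

text \<open>The defining relations of H(A) are homogeneous: homogenizations have the degree of the
  original relation, and commutators of generators have degree 2.\<close>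

lemma component_J: "p \<in> J \<Longrightarrow> component d p \<in> J"
proof (rule component_genideal[OF homogenized_relations])
  fix q assume "q \<in> homogenized_relations n R"
  then consider r where "r \<in> R" "q = homogenize r"
    | i where "q = var 0 * var i - var i * var 0"
    by (auto simp: homogenized_relations_def)
  then show "\<exists>e. Poly_Mapping.keys q \<subseteq> {w. wlen w = e}"
  proof cases
    case 1
    then show ?thesis
      using keys_homogenize_to[of r "ncdegree r"] by (auto simp: homogenize_eq)
  next
    case 2
    then have "Poly_Mapping.keys q \<subseteq> {w. wlen w = 2}"
      by (auto simp: var_def mult_single in_keys_iff lookup_minus lookup_single when_def
          split: if_splits)
    then show ?thesis ..
  qed
qed

text \<open>Setting x_0 = 1 is multiplicative, kills the commutators with x_0 and turns each
  homogenized relation back into the relation it came from.\<close>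

lemma dehomogenize_J:
  assumes "p \<in> J"
  shows "dehomogenize p \<in> I"
  using homogenized_relations assms
proof (induction p rule: free_algebra_genideal_induct)
  case (gen p)
  then consider r where "r \<in> R" "p = homogenize r"
    | i where "i \<in> {1..n}" "p = var 0 * var i - var i * var 0"
    by (auto simp: homogenized_relations_def)
  then show ?case
  proof cases
    case 1
    then have "dehomogenize p = r"
      using relations by (auto simp: homogenize_eq intro: dehomogenize_homogenize_to)
    then show ?thesis
      using 1 ring.genideal_self[OF ring_free_algebra relations] by auto
  qed (simp add: dehomogenize_var I_closed(2))
next
  case (left p u c)
  then show ?case
    by (auto intro!: I_closed(6) dehomogenize_in_free_algebra)
next
  case (right p u c)
  then show ?case
    by (auto intro!: I_closed(7) dehomogenize_in_free_algebra)
qed (simp_all add: I_closed(2,3))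

text \<open>On a single term the two sides differ only in whether the power of x_0 stands before or
  after \<open>u\<close>, and such powers are central modulo \<open>J\<close>.\<close>

lemma homogenize_to_single_times:
  assumes p: "p \<in> carrier (free_algebra {1..n})" and "ncdegree p \<le> d"
    and u: "set (letters u) \<subseteq> {1..n}"
  shows "homogenize_to (d + wlen u) (Poly_Mapping.single u c * p)
    - Poly_Mapping.single u c * homogenize_to d p \<in> J"
proof -
  have "Poly_Mapping.keys p \<subseteq> {w. wlen w \<le> d \<and> set (letters w) \<subseteq> {1..n}}"
    using assms by (auto simp: free_algebra_carrier_iff ncdegree_le_iff)
  then show ?thesis
  proof (induction p rule: poly_mapping_linear_induct)
    case zero
    show ?case by (simp add: J_closed(2))
  next
    case (single w a)
    let ?u = "Poly_Mapping.single u c" and ?w = "Poly_Mapping.single w a"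
    have comm: "(?u * var 0 ^ (d - wlen w) - var 0 ^ (d - wlen w) * ?u) * ?w \<in> J"
      using u single by (intro J_closed(7) var_0_power_central single_in_free_algebra) auto
    have "homogenize_to (d + wlen u) (?u * ?w) = var 0 ^ (d - wlen w) * (?u * ?w)"
      by (simp add: homogenize_to_single mult_single add.commute[of d])
    then have "- (homogenize_to (d + wlen u) (?u * ?w) - ?u * homogenize_to d ?w) =
        (?u * var 0 ^ (d - wlen w) - var 0 ^ (d - wlen w) * ?u) * ?w"
      by (simp add: homogenize_to_single algebra_simps)
    with comm have "- (homogenize_to (d + wlen u) (?u * ?w) - ?u * homogenize_to d ?w) \<in> J"
      by simp
    from J_closed(4)[OF this] show ?case by simp
  next
    case (add p q)
    from J_closed(3)[OF this] show ?case
      by (simp add: algebra_simps)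
  qed
qed

text \<open>The degree \<open>d\<close> is not tied to that of \<open>p\<close>, because an element
  of \<open>I\<close> may arise from summands of higher degree whose leading terms cancel.\<close>

lemma homogenize_to_I_exists:
  assumes "p \<in> I"
  shows "\<exists>d\<ge>ncdegree p. homogenize_to d p \<in> J"
  using relations assms
proof (induction p rule: free_algebra_genideal_induct)
  case zero
  show ?case by (auto simp: J_closed(2) ncdegree_def)
next
  case (add p q)
  then obtain d e where d: "ncdegree p \<le> d" "homogenize_to d p \<in> J"
    and e: "ncdegree q \<le> e" "homogenize_to e q \<in> J"
    by blast
  \<comment> \<open>The degree \<open>d + e\<close> serves both summands: it is reached from
    \<open>d\<close> and from \<open>e\<close> by multiplying with a power of x_0, which stays
    inside \<open>J\<close>.\<close>
  have "homogenize_to (d + e) p \<in> J" "homogenize_to (d + e) q \<in> J"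
    using d homogenize_to_shift[of p d e] e homogenize_to_shift[of q e d]
    by (simp_all add: add.commute[of d e] J_closed(6) power_in_free_algebra var_0)
  moreover have "ncdegree (p + q) \<le> d + e"
    using d(1) e(1) by (intro ncdegree_add_le) simp_all
  ultimately show ?case
    by (intro exI[of _ "d + e"]) (simp add: J_closed(3))
next
  case (gen p)
  then have "homogenize_to (ncdegree p) p \<in> J"
    using ring.genideal_self[OF ring_free_algebra homogenized_relations]
    by (auto simp: homogenized_relations_def homogenize_eq)
  then show ?case by blast
next
  case (left p u c)
  then obtain d where d: "ncdegree p \<le> d" "homogenize_to d p \<in> J"
    by blast
  have "Poly_Mapping.single u c * homogenize_to d p \<in> J"
    using left d by (intro J_closed(6) single_in_free_algebra) auto
  from J_closed(3)[OF homogenize_to_single_times[OF left(1) d(1) left(2), of c] this]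
  have "homogenize_to (d + wlen u) (Poly_Mapping.single u c * p) \<in> J"
    by simp
  moreover have "ncdegree (Poly_Mapping.single u c * p) \<le> d + wlen u"
    using d(1) ncdegree_mult_le[of "Poly_Mapping.single u c" p] ncdegree_single_le[of u c]
    by simp
  ultimately show ?case by blast
next
  case (right p u c)
  then obtain d where d: "ncdegree p \<le> d" "homogenize_to d p \<in> J"
    by blast
  have "homogenize_to d p * Poly_Mapping.single u c \<in> J"
    using right d by (intro J_closed(7) single_in_free_algebra) auto
  then have "homogenize_to (d + wlen u) (p * Poly_Mapping.single u c) \<in> J"
    using d by (simp add: homogenize_to_times_single)
  moreover have "ncdegree (p * Poly_Mapping.single u c) \<le> d + wlen u"
    using d(1) ncdegree_mult_le[of p "Poly_Mapping.single u c"] ncdegree_single_le[of u c]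
    by simp
  ultimately show ?case by blast
qed

text \<open>Modulo \<open>J\<close> all letters x_0 of a word can be collected on its left. As
  \<open>p\<close> is homogeneous of degree \<open>d\<close>, filling up to length \<open>d\<close>
  restores exactly as many of them as were erased.\<close>

lemma homogenize_to_dehomogenize:
  assumes p: "p \<in> carrier (free_algebra {0..n})"
    and homogeneous: "Poly_Mapping.keys p \<subseteq> {w. wlen w = d}"
  shows "homogenize_to d (dehomogenize p) - p \<in> J"
proof -
  let ?f = "filter (\<lambda>i::nat. i \<noteq> 0)"
  \<comment> \<open>The exponent is the number of letters 0 in \<open>xs\<close>.\<close>
  have word: "var 0 ^ (length xs - length (?f xs)) * Poly_Mapping.single (Word (?f xs)) c
      - Poly_Mapping.single (Word xs) c \<in> J" if "set xs \<subseteq> {0..n}" for xs c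
    using that
  proof (induction xs)
    case (Cons x xs)
    let ?k = "length xs - length (?f xs)"
    let ?s = "Poly_Mapping.single (Word (?f xs)) c" and ?t = "Poly_Mapping.single (Word xs) c"
    have split: "Poly_Mapping.single (Word (y # ys)) c = var y * Poly_Mapping.single (Word ys) c"
      for y ys
      by (simp add: var_def mult_single plus_word_def)
    have x: "var x \<in> carrier (free_algebra {0..n})"
      using Cons.prems by auto
    have IH: "var x * (var 0 ^ ?k * ?s - ?t) \<in> J"
      using Cons x by (intro J_closed(6)) auto
    show ?case
    proof (cases "x = 0")
      case True
      \<comment> \<open>The filtered word is never longer than \<open>xs\<close>, so the truncated
        subtraction gains exactly one for the new letter 0.\<close>
      have "Suc (length xs) - length (?f xs) = Suc ?k"
        using length_filter_le[of "\<lambda>i. i \<noteq> 0" xs] by linarith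
      then show ?thesis
        using True IH by (simp add: split algebra_simps)
    next
      case False
      have "?s \<in> carrier (free_algebra {0..n})"
        using Cons.prems by (intro single_in_free_algebra) auto
      \<comment> \<open>The new letter is moved to the right past the power of x_0 collected so
        far.\<close>
      then have "(var x * var 0 ^ ?k - var 0 ^ ?k * var x) * ?s \<in> J"
        by (intro J_closed(7) var_0_power_central x)
      from J_closed(5)[OF IH this] show ?thesis
        using False by (simp add: split algebra_simps)
    qed
  qed (simp add: J_closed(2))
  have "Poly_Mapping.keys p \<subseteq> {w. wlen w = d \<and> set (letters w) \<subseteq> {0..n}}"
    using assms by (auto simp: free_algebra_carrier_iff)
  then show ?thesis
  proof (induction p rule: poly_mapping_linear_induct)
    case (single w c)
    then show ?case
      using word[of "letters w" c] by (auto simp: dehomogenize_single homogenize_to_single)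
  next
    case (add p q)
    from J_closed(3)[OF this] show ?case
      by (simp add: algebra_simps)
  qed (simp add: J_closed(2))
qed

end

subsection \<open>A regular homogenizing element\<close>

locale regular_graded_presentation = graded_presentation +
  assumes regular: "\<not> zero_divisor (homogenization n R) (hom_residue n R (var 0))"
begin

text \<open>Regularity of x_0 in H(A) means that a factor x_0 can be cancelled modulo
  \<open>J\<close>; this is repeated \<open>k\<close> times.\<close>

lemma var_0_power_cancel:
  assumes "p \<in> carrier (free_algebra {0..n})" and "var 0 ^ k * p \<in> J"
  shows "p \<in> J"
proof -
  have cancel: "q \<in> J" if q: "q \<in> carrier (free_algebra {0..n})" "var 0 * q \<in> J" for q
  proof (rule ccontr)
    assume "q \<notin> J"
    let ?H = "presented_algebra {0..n} (homogenized_relations n R)"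
    let ?r = "residue {0..n} (homogenized_relations n R)"
    have zero_iff: "?r s = \<zero>\<^bsub>?H\<^esub> \<longleftrightarrow> s \<in> J" if "s \<in> carrier (free_algebra {0..n})" for s
      using residue_eq_iff[OF homogenized_relations that zero_in_free_algebra]
      by (simp add: residue_zero[OF homogenized_relations])
    have "?r (var 0) \<otimes>\<^bsub>?H\<^esub> ?r q = \<zero>\<^bsub>?H\<^esub>"
      using q var_0 zero_iff[OF free_algebra_closed(4)[OF var_0 q(1)]]
      by (simp add: residue_mult[OF homogenized_relations])
    moreover have "?r q \<noteq> \<zero>\<^bsub>?H\<^esub>"
      using q \<open>q \<notin> J\<close> zero_iff by blast
    ultimately have "zero_divisor ?H (?r (var 0))"
      using q(1) var_0 residue_closed[OF homogenized_relations]
      unfolding zero_divisor_def by blast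
    then show False
      using regular by (simp add: homogenization_def hom_residue_def)
  qed
  show ?thesis
    using assms(2)
  proof (induction k)
    case (Suc k)
    then have "var 0 * (var 0 ^ k * p) \<in> J"
      by (simp add: mult.assoc)
    then have "var 0 ^ k * p \<in> J"
      by (rule cancel[OF free_algebra_closed(4)[OF power_in_free_algebra[OF var_0] assms(1)]])
    then show ?case by (rule Suc.IH)
  qed simp
qed

text \<open>If homogenization to some degree \<open>e\<close> lands in \<open>J\<close>, then degree
  \<open>e + d\<close> can be reached both from \<open>e\<close> and from \<open>d\<close>. The
  first way shows membership in \<open>J\<close>, the second exhibits a factor x_0^e, which is
  cancelled.\<close>

lemma homogenize_to_I:
  assumes p: "p \<in> I" and d: "ncdegree p \<le> d"
  shows "homogenize_to d p \<in> J"
proof -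
  obtain e where e: "ncdegree p \<le> e" "homogenize_to e p \<in> J"
    using homogenize_to_I_exists[OF p] by blast
  have "var 0 ^ e * homogenize_to d p = homogenize_to (e + d) p"
    using homogenize_to_shift[OF d] by (simp only: add.commute[of e])
  also have "\<dots> = var 0 ^ d * homogenize_to e p"
    using e(1) by (rule homogenize_to_shift)
  also have "\<dots> \<in> J"
    using e(2) power_in_free_algebra[OF var_0] by (rule J_closed(6))
  finally have "var 0 ^ e * homogenize_to d p \<in> J" .
  moreover have "p \<in> carrier (free_algebra {1..n})"
    using p I_closed(1) by blast
  ultimately show ?thesis
    using var_0_power_cancel homogenize_to_in_free_algebra by blast
qed

text \<open>The commutator of x_i with \<open>p\<close> lies in \<open>I\<close>, and its
  homogenization to degree deg p + 1 agrees modulo \<open>J\<close> with the commutator of x_i with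
  the homogenization of \<open>p\<close>.\<close>

lemma homogenize_central:
  assumes p: "p \<in> carrier (free_algebra {1..n})"
    and central: "residue {1..n} R p \<in> ring_center (presented_algebra {1..n} R)"
  shows "hom_residue n R (homogenize p) \<in> ring_center (homogenization n R)"
proof -
  let ?d = "ncdegree p"
  have hp: "homogenize_to ?d p \<in> carrier (free_algebra {0..n})"
    using p by (rule homogenize_to_in_free_algebra)
  have "var i * homogenize_to ?d p - homogenize_to ?d p * var i \<in> J" if i: "i \<in> {0..n}" for i
  proof (cases "i = 0")
    case True
    from J_closed(4)[OF var_0_central[OF hp]] show ?thesis
      using True by simp
  next
    case False
    let ?c = "var i * p - p * var i"
    have "?c \<in> I"
      using iffD1[OF residue_in_center_iff[OF relations p] central]
      by (rule bspec) (use False i in simp)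
    \<comment> \<open>Leading terms may cancel in the commutator, so its degree is only bounded; the
      target degree \<open>Suc ?d\<close> must be prescribed to match the products.\<close>
    moreover have "ncdegree ?c \<le> Suc ?d"
      using ncdegree_mult_le[of "var i" p] ncdegree_mult_le[of p "var i"]
      by (intro ncdegree_diff_le) (simp_all add: ncdegree_var)
    ultimately have "homogenize_to (Suc ?d) ?c \<in> J"
      by (rule homogenize_to_I)
    moreover have "homogenize_to (Suc ?d) (p * var i) = homogenize_to ?d p * var i"
      using homogenize_to_times_single[of p ?d "Word [i]" 1] by (simp add: var_def)
    moreover have "homogenize_to (Suc ?d) (var i * p) - var i * homogenize_to ?d p \<in> J"
      using homogenize_to_single_times[OF p, of ?d "Word [i]" 1] i False by (simp add: var_def)
    ultimately have "homogenize_to (Suc ?d) (var i * p) - homogenize_to ?d p * var i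
        - (homogenize_to (Suc ?d) (var i * p) - var i * homogenize_to ?d p) \<in> J"
      by (intro J_closed(5)[of "_ - _"]) simp_all
    then show ?thesis
      by simp
  qed
  then have "\<forall>i\<in>{0..n}. var i * homogenize_to ?d p - homogenize_to ?d p * var i \<in> J" ..
  then show ?thesis
    unfolding homogenization_def hom_residue_def homogenize_eq
    by (rule iffD2[OF residue_in_center_iff[OF homogenized_relations hp]])
qed

section \<open>The two inclusions between the center of H(A) and H(Z(A))\<close>

lemma least_degree_rep_exists:
  assumes "p \<in> carrier (free_algebra {1..n})"
  obtains q where "least_degree_rep n R q" "residue {1..n} R q = residue {1..n} R p"
    "ncdegree q \<le> ncdegree p"
proof -
  let ?P = "\<lambda>q. q \<in> carrier (free_algebra {1..n}) \<and> residue {1..n} R q = residue {1..n} R p"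
  obtain q where "?P q" "\<And>r. ?P r \<Longrightarrow> ncdegree q \<le> ncdegree r"
    using assms ex_has_least_nat[of ?P p ncdegree] by auto
  then show ?thesis
    using assms that[of q] by (auto simp: least_degree_rep_def)
qed

text \<open>It is enough that the generators of the subalgebra are central: the scalars, x_0, and
  the homogenizations of central elements of A.\<close>

lemma homogenized_center_subset: "homogenized_center n R \<subseteq> ring_center (homogenization n R)"
  unfolding homogenized_center_def generated_subalgebra_def homogenization_def
proof (rule ring.generate_ring_subset_center[OF ring_presented_algebra[OF homogenized_relations]],
    intro Un_least insert_subsetI)
  let ?center = "ring_center (presented_algebra {0..n} (homogenized_relations n R))"
  show "range (\<lambda>c. residue {0..n} (homogenized_relations n R) (const c)) \<subseteq> ?center"
    by (auto simp: residue_in_center_iff[OF homogenized_relations] const_in_free_algebra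
        const_commute J_closed(2))
  show "hom_residue n R (var 0) \<in> ?center"
    unfolding hom_residue_def
    using var_0_central[OF var_in_free_algebra]
    by (subst residue_in_center_iff[OF homogenized_relations var_0]) blast
  show "{hom_residue n R (homogenize p) | p. least_degree_rep n R p
      \<and> residue {1..n} R p \<in> ring_center (presented_algebra {1..n} R)} \<subseteq> ?center"
    using homogenize_central by (auto simp: least_degree_rep_def homogenization_def)
qed

text \<open>Setting x_0 = 1 in the commutators with generators shows that \<open>p\<close> yields a
  central element of A. In H(A) the element \<open>p\<close> is then a power of x_0 times the
  homogenization of a least-degree representative, hence a product of generators of H(Z(A)).\<close>

lemma central_homogeneous:
  assumes p: "p \<in> carrier (free_algebra {0..n})"
    and homogeneous: "Poly_Mapping.keys p \<subseteq> {w. wlen w = d}"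
    and central: "hom_residue n R p \<in> ring_center (homogenization n R)"
  shows "hom_residue n R p \<in> homogenized_center n R"
proof -
  let ?r = "residue {0..n} (homogenized_relations n R)"
  let ?H = "presented_algebra {0..n} (homogenized_relations n R)"
  let ?p = "dehomogenize p"
  have dp: "?p \<in> carrier (free_algebra {1..n})"
    using p by (rule dehomogenize_in_free_algebra)
  have comm: "var i * p - p * var i \<in> J" if "i \<in> {0..n}" for i
    using central that residue_in_center_iff[OF homogenized_relations p]
    by (auto simp: hom_residue_def homogenization_def)
  have "var i * ?p - ?p * var i \<in> I" if "i \<in> {1..n}" for i
    using dehomogenize_J[OF comm[of i]] that by (simp add: dehomogenize_var)
  then have dcentral: "residue {1..n} R ?p \<in> ring_center (presented_algebra {1..n} R)"
    using residue_in_center_iff[OF relations dp] by blast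
  obtain q where q: "least_degree_rep n R q" "residue {1..n} R q = residue {1..n} R ?p"
    "ncdegree q \<le> ncdegree ?p"
    using least_degree_rep_exists[OF dp] .
  have qF: "q \<in> carrier (free_algebra {1..n})"
    using q(1) by (simp add: least_degree_rep_def)
  \<comment> \<open>Setting x_0 = 1 only deletes letters and cannot raise the degree above
    \<open>d\<close>.\<close>
  have deg: "ncdegree ?p \<le> d"
    unfolding ncdegree_le_iff using homogeneous
  proof (induction p rule: poly_mapping_linear_induct)
    case (add p q)
    then show ?case
      using Poly_Mapping.keys_add[of "dehomogenize p" "dehomogenize q"] by auto
  qed (auto simp: dehomogenize_single)
  \<comment> \<open>Two representatives of degree at most \<open>d\<close> have the same
    homogenization to degree \<open>d\<close> modulo \<open>J\<close>, and that of \<open>?p\<close>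
    gives back \<open>p\<close>.\<close>
  have "q - ?p \<in> I"
    using q(2) residue_eq_iff[OF relations qF dp] by simp
  moreover have "ncdegree (q - ?p) \<le> d"
    using order.trans[OF q(3) deg] deg by (rule ncdegree_diff_le)
  ultimately have "homogenize_to d (q - ?p) \<in> J"
    by (rule homogenize_to_I)
  from J_closed(3)[OF this homogenize_to_dehomogenize[OF p homogeneous]]
  have "homogenize_to d q - p \<in> J"
    by simp
  moreover have "homogenize_to d q = var 0 ^ (d - ncdegree q) * homogenize q"
    using homogenize_to_shift[of q "ncdegree q" "d - ncdegree q"] q(3) deg
    by (simp add: homogenize_eq)
  ultimately have eq: "var 0 ^ (d - ncdegree q) * homogenize q - p \<in> J"
    by simp
  have hq: "homogenize q \<in> carrier (free_algebra {0..n})"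
    using qF by (simp add: homogenize_eq homogenize_to_in_free_algebra)
  have "var 0 ^ (d - ncdegree q) * homogenize q \<in> carrier (free_algebra {0..n})"
    by (rule free_algebra_closed(4)[OF power_in_free_algebra[OF var_0] hq])
  then have "?r p = ?r (var 0 ^ (d - ncdegree q) * homogenize q)"
    using eq p by (intro residue_eq_iff[OF homogenized_relations, THEN iffD2, symmetric])
  moreover have "?r (var 0 ^ k * homogenize q) \<in> homogenized_center n R" for k
  proof (induction k)
    case 0
    show ?case
      unfolding homogenized_center_def generated_subalgebra_def
      using q(1,2) dcentral by (intro generate_ring.incl) (auto simp: hom_residue_def)
  next
    case (Suc k)
    have "?r (var 0) \<in> homogenized_center n R"
      unfolding homogenized_center_def generated_subalgebra_def
      by (intro generate_ring.incl) (auto simp: hom_residue_def)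
    then have "?r (var 0) \<otimes>\<^bsub>?H\<^esub> ?r (var 0 ^ k * homogenize q) \<in> homogenized_center n R"
      using Suc unfolding homogenized_center_def generated_subalgebra_def
      by (rule generate_ring.eng_mult)
    then show ?case
      using hq var_0
      by (simp add: free_algebra_closed(4) power_in_free_algebra mult.assoc
          flip: residue_mult[OF homogenized_relations])
  qed
  ultimately show ?thesis
    by (simp add: hom_residue_def)
qed

text \<open>A central element is the sum of the residues of the components of a representative. As
  \<open>J\<close> is homogeneous, each of these residues is central as well, so the homogeneous
  case applies to every summand.\<close>

lemma ring_center_subset: "ring_center (homogenization n R) \<subseteq> homogenized_center n R"
proof
  let ?r = "residue {0..n} (homogenized_relations n R)"
  fix z assume z: "z \<in> ring_center (homogenization n R)"
  then obtain p where p: "p \<in> carrier (free_algebra {0..n})" "z = ?r p"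
    using presented_algebra_cases[OF homogenized_relations]
    by (auto simp: ring_center_def homogenization_def)
  have "?r (component d p) \<in> homogenized_center n R" for d
    unfolding hom_residue_def[symmetric]
  proof (rule central_homogeneous)
    show "component d p \<in> carrier (free_algebra {0..n})"
      using p by auto
    show "Poly_Mapping.keys (component d p) \<subseteq> {w. wlen w = d}"
      by (auto simp: keys_component)
    have "var i * component d p - component d p * var i \<in> J" if i: "i \<in> {0..n}" for i
    proof -
      have "var i * p - p * var i \<in> J"
        using z p i residue_in_center_iff[OF homogenized_relations p(1)]
        by (auto simp: homogenization_def)
      \<comment> \<open>Generators have degree 1, so the component of degree \<open>d + 1\<close> of
        the commutator of x_i with \<open>p\<close> is the commutator of x_i with the component of
        degree \<open>d\<close>.\<close>
      from component_J[OF this, of "Suc d"] show ?thesis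
        by (simp add: var_def component_single_times component_times_single)
    qed
    then show "hom_residue n R (component d p) \<in> ring_center (homogenization n R)"
      using residue_in_center_iff[OF homogenized_relations component_in_free_algebra[OF p(1)]]
      by (simp add: hom_residue_def homogenization_def)
  qed
  note homogeneous = this
  have "?r (\<Sum>d\<in>D. component d p) \<in> homogenized_center n R" if "finite D" for D
    using that
  proof (induction D rule: finite_induct)
    case empty
    show ?case
      using ring.zero_in_generate[OF ring_presented_algebra[OF homogenized_relations]]
      by (simp add: residue_zero[OF homogenized_relations] homogenized_center_def
          generated_subalgebra_def)
  next
    case (insert d D)
    have "?r (component d p + (\<Sum>d\<in>D. component d p))
        = ?r (component d p) \<oplus>\<^bsub>presented_algebra {0..n} (homogenized_relations n R)\<^esub>
          ?r (\<Sum>d\<in>D. component d p)"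
      using p(1) by (intro residue_add[OF homogenized_relations] sum_in_free_algebra) auto
    then show ?case
      using insert homogeneous[of d]
      by (simp add: homogenized_center_def generated_subalgebra_def generate_ring.eng_add)
  qed
  from this[of "{..ncdegree p}"] show "z \<in> homogenized_center n R"
    by (simp add: sum_components p(2))
qed

end

theorem proposition2p5:
  fixes n m :: nat
    and f :: "nat \<Rightarrow> (nat, 'k::{alg_closed_field, field_char_0}) ncpoly"
  assumes "\<And>j. j \<in> {1..m} \<Longrightarrow> f j \<in> carrier (free_algebra {1..n})"
    and "\<not> zero_divisor (homogenization n (f ` {1..m})) (hom_residue n (f ` {1..m}) (var 0))"
  shows "ring_center (homogenization n (f ` {1..m})) = homogenized_center n (f ` {1..m})"
proof -
  interpret regular_graded_presentation n "f ` {1..m}"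
    using assms by unfold_locales auto
  show ?thesis
    using ring_center_subset homogenized_center_subset by (rule equalityI)
qed

end
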